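(* Let $\mathcal{H}_1,\mathcal{H}_2$ be Hilbert spaces over $\mathbb{F}=\mathbb{R}$ or $\mathbb{F}=\mathbb{C}$, let $K$ be a positive integer, and let $\{A_k\}_{k=1}^{K}\subset \mathcal{BC}(\mathcal{H}_1,\mathcal{H}_2)$. Assume that $\mathrm{R}(A_k)\subseteq \mathrm{N}(A_{k'}^{*})$ and $\mathrm{R}(A_k^{*})\subseteq \mathrm{N}(A_{k'})$ for each $k,k'=1,\ldots,K$, $k\neq k'$. Let $k_0\in\{1,\ldots,K\}$. The following assertions hold: (i) $A_{k_0}^{\dagger}=\left(\sum_{k=1}^{K}A_k^{*}\right)\left(\sum_{k=1}^{K}A_kA_k^{*}\right)^{\dagger}-\sum_{k=1,k\neq k_0}^{K}A_k^{\dagger}$. (ii) $A_{k_0}^{\dagger}\left(\sum_{k=1}^{K}A_kA_k^{*}\right)=A_{k_0}^{*}$ and $A_{k_0}^{\dagger}=A_{k_0}^{*}\left(\sum_{k=1}^{K}A_kA_k^{*}\right)^{\dagger}$. (iii) $\mathrm{R}\left(\sum_{k=1}^{K}A_k\right)=\mathcal{H}_2$ if and only if $\mathrm{R}\left(\sum_{k=1,k\neq k_0}^{K}A_k\right)=\mathrm{N}(A_{k_0}^{*})$. (iv) If $\mathrm{R}\left(\sum_{k=1}^{K}A_k\right)=\mathcal{H}_2$, then $\sum_{k=1}^{K}A_kA_k^{*}$ is invertible.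
   Context: $\mathcal{BC}(\mathcal{H}_1,\mathcal{H}_2)$ is the set of bounded linear operators from $\mathcal{H}_1$ to $\mathcal{H}_2$ with closed range. $A^{*}$, $\mathrm{N}(A)$, $\mathrm{R}(A)$ denote the adjoint, null space and range of $A$. For $A\in\mathcal{BC}(\mathcal{H}_1,\mathcal{H}_2)$, the Moore--Penrose inverse $A^{\dagger}\in\mathcal{BC}(\mathcal{H}_2,\mathcal{H}_1)$ is the unique solution $X$ of $AXA=A$, $XAX=X$, $(AX)^{*}=AX$, $(XA)^{*}=XA$. A bounded operator has a Moore--Penrose inverse if and only if its range is closed; the existence of the Moore--Penrose inverse of $\sum_{k=1}^{K}A_kA_k^{*}$ is part of the assertion. *)

theory Defs
  imports "HOL-Analysis.Analysis"
begin

(* The scalar field is a parameter F :: complex set with F = \<real> or F = UNIV, so that real and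
   complex Hilbert spaces are treated by one notion. The vectors form a complete normed space
   (class banach); the record adds the scalar multiplication and the inner product.
   hscale H c is only meaningful for c in F. *)
record 'a hilbert_str =
  hscale :: "complex \<Rightarrow> 'a \<Rightarrow> 'a"
  hinner :: "'a \<Rightarrow> 'a \<Rightarrow> complex"

(* The axiom norm_eq gives positive definiteness and says that the norm, hence also the topology,
   boundedness and completeness of the class banach, are those induced by the inner product. *)
locale hilbert_space =
  fixes F :: "complex set" and H :: "('a::banach) hilbert_str"
  assumes scalars: "F = \<real> \<or> F = UNIV"
    and scale_add_right: "c \<in> F \<Longrightarrow> hscale H c (x + y) = hscale H c x + hscale H c y"
    and scale_add_left: "c \<in> F \<Longrightarrow> d \<in> F \<Longrightarrow> hscale H (c + d) x = hscale H c x + hscale H d x"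
    and scale_scale: "c \<in> F \<Longrightarrow> d \<in> F \<Longrightarrow> hscale H c (hscale H d x) = hscale H (c * d) x"
    and scale_of_real: "hscale H (of_real r) x = r *\<^sub>R x"
    and hinner_scalar: "hinner H x y \<in> F"
    and hinner_commute: "hinner H x y = cnj (hinner H y x)"
    and hinner_add_left: "hinner H (x + y) z = hinner H x z + hinner H y z"
    and hinner_scale_left: "c \<in> F \<Longrightarrow> hinner H (hscale H c x) y = c * hinner H x y"
    and norm_eq: "hinner H x x = of_real ((norm x)\<^sup>2)"

definition bounded_op ::
  "complex set \<Rightarrow> ('a::banach) hilbert_str \<Rightarrow> ('b::banach) hilbert_str \<Rightarrow> ('a \<Rightarrow> 'b) \<Rightarrow> bool" where
  "bounded_op F H1 H2 A \<longleftrightarrow>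
     bounded_linear A \<and> (\<forall>c\<in>F. \<forall>x. A (hscale H1 c x) = hscale H2 c (A x))"

definition BC ::
  "complex set \<Rightarrow> ('a::banach) hilbert_str \<Rightarrow> ('b::banach) hilbert_str \<Rightarrow> ('a \<Rightarrow> 'b) set" where
  "BC F H1 H2 = {A. bounded_op F H1 H2 A \<and> closed (range A)}"

definition invertible_op ::
  "complex set \<Rightarrow> ('a::banach) hilbert_str \<Rightarrow> ('b::banach) hilbert_str \<Rightarrow> ('a \<Rightarrow> 'b) \<Rightarrow> bool" where
  "invertible_op F H1 H2 A \<longleftrightarrow>
     bounded_op F H1 H2 A \<and> (\<exists>T. bounded_op F H2 H1 T \<and> T \<circ> A = id \<and> A \<circ> T = id)"

definition null_space :: "('a \<Rightarrow> 'b::zero) \<Rightarrow> 'a set" where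
  "null_space A = {x. A x = 0}"

(* The defining identity determines the adjoint uniquely, and for a bounded operator between
   Hilbert spaces it exists by the Riesz representation theorem. *)
definition hadjoint ::
  "('a::banach) hilbert_str \<Rightarrow> ('b::banach) hilbert_str \<Rightarrow> ('a \<Rightarrow> 'b) \<Rightarrow> ('b \<Rightarrow> 'a)" where
  "hadjoint H1 H2 A = (THE B. \<forall>x y. hinner H2 (A x) y = hinner H1 x (B y))"

definition is_mp_inverse ::
  "complex set \<Rightarrow> ('a::banach) hilbert_str \<Rightarrow> ('b::banach) hilbert_str
    \<Rightarrow> ('a \<Rightarrow> 'b) \<Rightarrow> ('b \<Rightarrow> 'a) \<Rightarrow> bool" where
  "is_mp_inverse F H1 H2 A X \<longleftrightarrow>
     X \<in> BC F H2 H1 \<and> A \<circ> X \<circ> A = A \<and> X \<circ> A \<circ> X = X \<and>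
     hadjoint H2 H2 (A \<circ> X) = A \<circ> X \<and> hadjoint H1 H1 (X \<circ> A) = X \<circ> A"

definition mp_inverse ::
  "complex set \<Rightarrow> ('a::banach) hilbert_str \<Rightarrow> ('b::banach) hilbert_str
    \<Rightarrow> ('a \<Rightarrow> 'b) \<Rightarrow> ('b \<Rightarrow> 'a)" where
  "mp_inverse F H1 H2 A = (THE X. is_mp_inverse F H1 H2 A X)"

(* The library's real Hilbert spaces, with the library's inner product, bounded linear maps and
   adjoint, are the case F = \<real>. *)
definition real_hilbert :: "('a::{real_inner,banach}) hilbert_str" where
  "real_hilbert = \<lparr>hscale = (\<lambda>c x. Re c *\<^sub>R x), hinner = (\<lambda>x y. of_real (inner x y))\<rparr>"

lemma hilbert_space_real: "hilbert_space \<real> real_hilbert"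
proof
  fix c d :: complex and x y :: 'a
  assume "c \<in> \<real>" "d \<in> \<real>"
  then obtain r s where "c = of_real r" "d = of_real s"
    by (auto elim!: Reals_cases)
  then show "hscale real_hilbert c (hscale real_hilbert d x) = hscale real_hilbert (c * d) x"
    by (simp add: real_hilbert_def)
next
  fix c :: complex and x y :: 'a
  assume "c \<in> \<real>"
  then obtain r where "c = of_real r"
    by (auto elim!: Reals_cases)
  then show "hinner real_hilbert (hscale real_hilbert c x) y = c * hinner real_hilbert x y"
    by (simp add: real_hilbert_def)
qed (simp_all add: real_hilbert_def scaleR_add_right scaleR_add_left inner_add_left
    inner_add_right power2_norm_eq_inner inner_commute)

lemma bounded_op_real: "bounded_op \<real> real_hilbert real_hilbert A \<longleftrightarrow> bounded_linear A"
  by (simp add: bounded_op_def real_hilbert_def linear_cmul bounded_linear.linear cong: conj_cong)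

lemma hadjoint_real:
  fixes A :: "'a::{real_inner,banach} \<Rightarrow> 'b::{real_inner,banach}"
  assumes adj: "\<forall>x y. inner (A x) y = inner x (B y)"
  shows "hadjoint real_hilbert real_hilbert A = adjoint A"
proof -
  have "hadjoint real_hilbert real_hilbert A = B"
    unfolding hadjoint_def
  proof (rule the_equality)
    fix C :: "'b \<Rightarrow> 'a"
    assume "\<forall>x y. hinner real_hilbert (A x) y = hinner real_hilbert x (C y)"
    then have "inner x (C y) = inner x (B y)" for x y
      using adj by (simp add: real_hilbert_def)
    then show "C = B"
      using vector_eq_ldot by blast
  qed (use adj in \<open>simp add: real_hilbert_def\<close>)
  with adjoint_unique[OF adj] show ?thesis
    by simp
qed

(* The scalars themselves, as a one-dimensional complex Hilbert space. *)
lemma hilbert_space_complex: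
  "hilbert_space UNIV \<lparr>hscale = (*), hinner = (\<lambda>x y::complex. x * cnj y)\<rparr>"
  by unfold_locales
    (simp_all add: distrib_left distrib_right mult.assoc scaleR_conv_of_real complex_norm_square
      del: of_real_power)

end

theory Submission
  imports Defs
begin

text \<open>The open mapping theorem (through uniform boundedness) shows that a closed-range operator \<open>A\<close> has
  \<open>A\<^sup>*\<close> bounded below on the range of \<open>A\<close>, so \<open>A A\<^sup>*\<close> is invertible there and \<open>A\<close> has a
  Moore--Penrose inverse. For the mutually orthogonal family, all cross terms among \<open>A\<^sub>k\<close>,
  \<open>A\<^sub>k\<^sup>*\<close> and \<open>X\<^sub>k = A\<^sub>k\<^sup>\<dagger>\<close> vanish, so that \<open>G = \<Sum>\<^sub>k X\<^sub>k\<^sup>* X\<^sub>k\<close> is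
  the Moore--Penrose inverse of \<open>S = \<Sum>\<^sub>k A\<^sub>k A\<^sub>k\<^sup>*\<close>, with \<open>S G = G S = \<Sum>\<^sub>k A\<^sub>k X\<^sub>k\<close>. The
  assertions follow from \<open>X\<^sub>k S = A\<^sub>k\<^sup>*\<close> and \<open>A\<^sub>k\<^sup>* G = X\<^sub>k\<close>.\<close>

section \<open>Projections and the Riesz representation\<close>

context hilbert_space
begin

section \<open>Algebra of the inner product and the Cauchy-Schwarz inequality\<close>

lemma of_real_scalar [simp]: "of_real r \<in> F"
  using scalars by auto

lemma cnj_scalar: "c \<in> F \<Longrightarrow> cnj c \<in> F"
  using scalars by (auto simp: Reals_cnj_iff)

text \<open>Both choices of \<open>F\<close> are fields, so the quotients of inner products used
  below as coefficients are admissible scalars.\<close>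

lemma divide_scalar: "c \<in> F \<Longrightarrow> d \<in> F \<Longrightarrow> c / d \<in> F"
  using scalars by auto

lemma hinner_add_right: "hinner H x (y + z) = hinner H x y + hinner H x z"
  by (metis hinner_commute hinner_add_left complex_cnj_add)

lemma hinner_scale_right: "c \<in> F \<Longrightarrow> hinner H x (hscale H c y) = cnj c * hinner H x y"
  by (metis hinner_commute hinner_scale_left complex_cnj_mult)

lemma hinner_scaleR_left: "hinner H (r *\<^sub>R x) y = of_real r * hinner H x y"
  by (metis hinner_scale_left of_real_scalar scale_of_real)

lemma hinner_scaleR_right: "hinner H x (r *\<^sub>R y) = of_real r * hinner H x y"
  by (metis hinner_scale_right of_real_scalar scale_of_real complex_cnj_complex_of_real)

lemma hinner_zero_left [simp]: "hinner H 0 y = 0"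
  using hinner_scaleR_left[of 0] by simp

lemma hinner_zero_right [simp]: "hinner H x 0 = 0"
  using hinner_scaleR_right[of _ 0] by simp

lemma hinner_minus_left: "hinner H (- x) y = - hinner H x y"
  using hinner_scaleR_left[of "-1"] by simp

lemma hinner_minus_right: "hinner H x (- y) = - hinner H x y"
  using hinner_scaleR_right[of _ "-1"] by simp

lemma hinner_diff_left: "hinner H (x - y) z = hinner H x z - hinner H y z"
  using hinner_add_left[of x "- y"] by (simp add: hinner_minus_left)

lemma hinner_diff_right: "hinner H x (y - z) = hinner H x y - hinner H x z"
  using hinner_add_right[of _ y "- z"] by (simp add: hinner_minus_right)

lemma hinner_sum_left: "hinner H (\<Sum>i\<in>I. f i) y = (\<Sum>i\<in>I. hinner H (f i) y)"
  by (induction I rule: infinite_finite_induct) (auto simp: hinner_add_left)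

lemma hinner_sum_right: "hinner H x (\<Sum>i\<in>I. f i) = (\<Sum>i\<in>I. hinner H x (f i))"
  by (induction I rule: infinite_finite_induct) (auto simp: hinner_add_right)

lemma hinner_swap_zero: "hinner H x y = 0 \<Longrightarrow> hinner H y x = 0"
  by (metis hinner_commute complex_cnj_zero)

lemma hinner_self_eq_0: "hinner H x x = 0 \<longleftrightarrow> x = 0"
  by (simp add: norm_eq)

text \<open>Test against \<open>y - z\<close> itself. Together with its mirror image this reduces
  most of the later operator identities to moving operators across the inner product.\<close>

lemma hinner_eqI_right: "(\<And>x. hinner H x y = hinner H x z) \<Longrightarrow> y = z"
  using hinner_self_eq_0[of "y - z"] by (simp add: hinner_diff_right)

lemma hinner_eqI_left: "(\<And>x. hinner H y x = hinner H z x) \<Longrightarrow> y = z"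
  using hinner_self_eq_0[of "y - z"] by (simp add: hinner_diff_left)

lemma hscale_zero: "c \<in> F \<Longrightarrow> hscale H c 0 = 0"
  using scale_add_right[of c 0 0] by simp

lemma hscale_diff: "c \<in> F \<Longrightarrow> hscale H c (x - y) = hscale H c x - hscale H c y"
  by (metis scale_add_right add_diff_cancel diff_add_cancel)

lemma hscale_sum: "c \<in> F \<Longrightarrow> hscale H c (\<Sum>i\<in>I. f i) = (\<Sum>i\<in>I. hscale H c (f i))"
  by (induction I rule: infinite_finite_induct) (auto simp: hscale_zero scale_add_right)

lemma norm_square: "(norm x)\<^sup>2 = Re (hinner H x x)"
  by (simp add: norm_eq)

lemma parallelogram:
  fixes x y :: 'a
  shows "(norm (x + y))\<^sup>2 + (norm (x - y))\<^sup>2 = 2 * (norm x)\<^sup>2 + 2 * (norm y)\<^sup>2"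
  by (simp add: norm_square hinner_add_left hinner_add_right hinner_diff_left hinner_diff_right)

text \<open>Pythagoras after removing from \<open>x\<close> its component along \<open>y\<close>.
  Nonnegativity of the left side gives Cauchy-Schwarz; minimality of a distance forces the
  subtracted term to vanish in \<open>orthogonal_projection\<close>.\<close>

lemma norm_minus_component:
  assumes "y \<noteq> 0"
  shows "(norm (x - hscale H (hinner H x y / of_real ((norm y)\<^sup>2)) y))\<^sup>2
    = (norm x)\<^sup>2 - (cmod (hinner H x y))\<^sup>2 / (norm y)\<^sup>2"
proof -
  define c where "c = hinner H x y / of_real ((norm y)\<^sup>2)"
  have c: "c \<in> F"
    unfolding c_def by (intro divide_scalar hinner_scalar of_real_scalar)
  have cy: "c * of_real ((norm y)\<^sup>2) = hinner H x y"
    using assms by (simp add: c_def)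
  have "hinner H (x - hscale H c y) (x - hscale H c y)
      = hinner H x x - cnj c * hinner H x y - c * (hinner H y x - cnj c * hinner H y y)"
    by (simp add: hinner_diff_left hinner_diff_right hinner_scale_left hinner_scale_right c algebra_simps)
  also have "\<dots> = hinner H x x - cnj c * (c * of_real ((norm y)\<^sup>2))
      - c * (cnj (c * of_real ((norm y)\<^sup>2)) - cnj c * of_real ((norm y)\<^sup>2))"
    by (simp only: cy norm_eq[of y] flip: hinner_commute[of y x])
  also have "\<dots> = of_real ((norm x)\<^sup>2 - (cmod c)\<^sup>2 * (norm y)\<^sup>2)"
    by (simp add: norm_eq algebra_simps complex_norm_square del: of_real_power)
  finally have "(norm (x - hscale H c y))\<^sup>2 = (norm x)\<^sup>2 - (cmod c)\<^sup>2 * (norm y)\<^sup>2"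
    by (simp add: norm_eq del: of_real_power of_real_diff of_real_mult)
  moreover have "(cmod c)\<^sup>2 * (norm y)\<^sup>2 = (cmod (hinner H x y))\<^sup>2 / (norm y)\<^sup>2"
    using assms by (simp add: c_def norm_divide power_divide field_simps norm_power)
  ultimately show ?thesis
    by (simp add: c_def)
qed

lemma Cauchy_Schwarz: "cmod (hinner H x y) \<le> norm x * norm y"
proof (cases "y = 0")
  case False
  have "0 \<le> (norm x)\<^sup>2 - (cmod (hinner H x y))\<^sup>2 / (norm y)\<^sup>2"
    by (metis norm_minus_component[OF False] zero_le_power2)
  then have "(cmod (hinner H x y))\<^sup>2 \<le> (norm x * norm y)\<^sup>2"
    using False by (simp add: field_simps)
  then show ?thesis
    by (rule power2_le_imp_le) simp
qed simp

lemma bounded_linear_hinner_left: "bounded_linear (\<lambda>x. hinner H x y)"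
  by (rule bounded_linear_intro[where K = "norm y"])
    (auto simp: hinner_add_left hinner_scaleR_left scaleR_conv_of_real intro: Cauchy_Schwarz)

section \<open>Nearest points, orthogonal projections and linear functionals\<close>

definition closed_subspace :: "'a set \<Rightarrow> bool" where
  "closed_subspace M \<longleftrightarrow> closed M \<and> 0 \<in> M \<and> (\<forall>x\<in>M. \<forall>y\<in>M. x + y \<in> M) \<and>
     (\<forall>c\<in>F. \<forall>x\<in>M. hscale H c x \<in> M)"

lemma closed_subspace_scaleR: "closed_subspace M \<Longrightarrow> x \<in> M \<Longrightarrow> r *\<^sub>R x \<in> M"
  unfolding closed_subspace_def by (metis of_real_scalar scale_of_real)

lemma closed_subspace_diff:
  assumes "closed_subspace M" "x \<in> M" "y \<in> M" shows "x - y \<in> M"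
proof -
  have "x + (-1) *\<^sub>R y \<in> M"
    using assms closed_subspace_scaleR[of M y "-1"] unfolding closed_subspace_def by blast
  then show ?thesis by simp
qed

text \<open>A minimizing sequence is Cauchy by the parallelogram law, and its limit stays in the
  closed set \<open>M\<close>.\<close>

lemma nearest_point:
  assumes M: "closed_subspace M"
  obtains p where "p \<in> M" "\<And>m. m \<in> M \<Longrightarrow> norm (x - p) \<le> norm (x - m)"
proof -
  define d where "d = infdist x M"
  have ne: "M \<noteq> {}" and cl: "closed M"
    using M by (auto simp: closed_subspace_def)
  have d_le: "d \<le> norm (x - m)" if "m \<in> M" for m
    using infdist_le[OF that, of x] by (simp add: d_def dist_norm)
  have d0: "0 \<le> d"
    by (simp add: d_def infdist_nonneg)
  have "\<exists>m\<in>M. norm (x - m) < d + inverse (real (Suc n))" for n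
  proof -
    have "infdist x M < d + inverse (real (Suc n))"
      unfolding d_def[symmetric] by simp
    then show ?thesis
      using ne by (subst (asm) infdist_notempty, simp, subst (asm) cINF_less_iff)
        (auto simp: dist_norm intro!: bdd_belowI2[where m = 0])
  qed
  then obtain m where mM: "\<And>n. m n \<in> M" and m: "\<And>n. norm (x - m n) < d + inverse (real (Suc n))"
    by metis
  \<comment> \<open>The midpoint of \<open>m i\<close> and \<open>m j\<close> lies in
    \<open>M\<close>, so its distance from \<open>x\<close> is at least \<open>d\<close>; this
    bounds the sum term of the parallelogram law from below.\<close>
  have bound: "(norm (m i - m j))\<^sup>2 \<le> 2 * (norm (x - m i))\<^sup>2 + 2 * (norm (x - m j))\<^sup>2 - 4 * d\<^sup>2" for i j
  proof -
    have "(1/2) *\<^sub>R (m i + m j) \<in> M"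
      using M mM closed_subspace_scaleR[OF M] by (auto simp: closed_subspace_def)
    then have "d \<le> norm (x - (1/2) *\<^sub>R (m i + m j))"
      by (rule d_le)
    moreover have "(x - m i) + (x - m j) = 2 *\<^sub>R (x - (1/2) *\<^sub>R (m i + m j))"
      by (simp add: algebra_simps scaleR_2)
    ultimately have "2 * d \<le> norm ((x - m i) + (x - m j))"
      by simp
    then have "4 * d\<^sup>2 \<le> (norm ((x - m i) + (x - m j)))\<^sup>2"
      using power_mono[of "2 * d" _ 2] d0 by (simp add: power_mult_distrib)
    moreover have "(x - m i) - (x - m j) = - (m i - m j)"
      by simp
    ultimately show ?thesis
      using parallelogram[of "x - m i" "x - m j"] by (simp add: norm_minus_commute)
  qed
  have lim: "(\<lambda>n. norm (x - m n)) \<longlonglongrightarrow> d"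
  proof (rule tendsto_sandwich)
    show "\<forall>\<^sub>F n in sequentially. norm (x - m n) \<le> d + inverse (real (Suc n))"
      by (intro always_eventually allI less_imp_le m)
    show "\<forall>\<^sub>F n in sequentially. d \<le> norm (x - m n)"
      using d_le mM by auto
    show "(\<lambda>n. d + inverse (real (Suc n))) \<longlonglongrightarrow> d"
      using tendsto_add[OF tendsto_const LIMSEQ_inverse_real_of_nat, of d] by simp
  qed auto
  have "Cauchy m"
  proof (rule metric_CauchyI)
    fix e :: real assume e: "0 < e"
    have "(\<lambda>n. (norm (x - m n))\<^sup>2) \<longlonglongrightarrow> d\<^sup>2"
      by (intro tendsto_intros lim)
    \<comment> \<open>The slack of one quarter is fitted to \<open>bound\<close>: two squared
      distances, each doubled, contribute exactly \<open>e\<^sup>2\<close> beyond the cancelled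
      \<open>4 * d\<^sup>2\<close>.\<close>
    moreover have "d\<^sup>2 < d\<^sup>2 + e\<^sup>2 / 4"
      using e by simp
    ultimately obtain N where N: "\<And>n. N \<le> n \<Longrightarrow> (norm (x - m n))\<^sup>2 < d\<^sup>2 + e\<^sup>2 / 4"
      by (metis (no_types, lifting) order_tendstoD(2) eventually_sequentially)
    have "dist (m i) (m j) < e" if "N \<le> i" "N \<le> j" for i j
    proof (rule power2_less_imp_less)
      show "(dist (m i) (m j))\<^sup>2 < e\<^sup>2"
        using bound[of i j] N[OF that(1)] N[OF that(2)] by (simp add: dist_norm)
    qed (use e in simp)
    then show "\<exists>N. \<forall>i\<ge>N. \<forall>j\<ge>N. dist (m i) (m j) < e"
      by blast
  qed
  then obtain p where p: "m \<longlonglongrightarrow> p"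
    using Cauchy_convergent convergent_def by blast
  show thesis
  proof
    show "p \<in> M"
      using cl mM p closed_sequentially by blast
    have "(\<lambda>n. norm (x - m n)) \<longlonglongrightarrow> norm (x - p)"
      by (intro tendsto_intros p)
    then have "norm (x - p) = d"
      using lim LIMSEQ_unique by blast
    then show "norm (x - p) \<le> norm (x - q)" if "q \<in> M" for q
      using d_le[OF that] by simp
  qed
qed

text \<open>If the residual at the nearest point \<open>p\<close> were not orthogonal to
  \<open>m\<close>, adding to \<open>p\<close> the component of the residual along \<open>m\<close>
  would come strictly closer.\<close>

lemma orthogonal_projection:
  assumes M: "closed_subspace M"
  obtains p where "p \<in> M" "\<And>m. m \<in> M \<Longrightarrow> hinner H (x - p) m = 0"
proof -
  obtain p where p: "p \<in> M" and near: "\<And>m. m \<in> M \<Longrightarrow> norm (x - p) \<le> norm (x - m)"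
    using nearest_point[OF M] by blast
  have "hinner H (x - p) m = 0" if m: "m \<in> M" for m
  proof (cases "m = 0")
    case False
    define q where "q = hscale H (hinner H (x - p) m / of_real ((norm m)\<^sup>2)) m"
    have "q \<in> M"
      using M m unfolding q_def closed_subspace_def
      by (meson divide_scalar hinner_scalar of_real_scalar)
    with p have "p + q \<in> M"
      using M by (simp add: closed_subspace_def)
    then have "(norm (x - p))\<^sup>2 \<le> (norm (x - p - q))\<^sup>2"
      using near by (simp add: diff_diff_eq power_mono)
    then have "(cmod (hinner H (x - p) m))\<^sup>2 / (norm m)\<^sup>2 \<le> 0"
      unfolding q_def norm_minus_component[OF False] by simp
    then show ?thesis
      using False by (simp add: divide_le_0_iff not_sum_power2_lt_zero)
  qed simp
  with p show thesis
    using that by blast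
qed

text \<open>A nonzero functional is determined by its kernel and its value at one vector
  \<open>w\<close> orthogonal to the kernel; \<open>w\<close> is the residual of projecting some
  \<open>u\<close> with \<open>f u \<noteq> 0\<close>.\<close>

lemma Riesz_representation:
  fixes f :: "'a \<Rightarrow> complex"
  assumes f: "bounded_linear f" and scale: "\<And>c x. c \<in> F \<Longrightarrow> f (hscale H c x) = c * f x"
    and scalar: "\<And>x. f x \<in> F"
  obtains y where "\<And>x. f x = hinner H x y"
proof (cases "\<forall>x. f x = 0")
  case True
  then show ?thesis using that[of 0] by simp
next
  case False
  interpret f: bounded_linear f by fact
  obtain u where u: "f u \<noteq> 0" using False by blast
  define N where "N = {x. f x = 0}"
  have "closed N"
    unfolding N_def using f by (intro closed_Collect_eq continuous_intros linear_continuous_on)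
  then have "closed_subspace N"
    by (auto simp: closed_subspace_def N_def f.zero f.add scale)
  then obtain p where p: "p \<in> N" and orth: "\<And>m. m \<in> N \<Longrightarrow> hinner H (u - p) m = 0"
    using orthogonal_projection by blast
  define w where "w = u - p"
  have fw: "f w = f u"
    using p by (simp add: w_def N_def f.diff)
  then have w0: "w \<noteq> 0"
    using u f.zero by force
  have "f x = hinner H x (hscale H (cnj (f w) / of_real ((norm w)\<^sup>2)) w)" for x
  proof -
    \<comment> \<open>This coefficient puts \<open>x - hscale H c w\<close> into the kernel, hence
      makes it orthogonal to \<open>w\<close>.\<close>
    define c where "c = f x / f w"
    have c: "c \<in> F"
      unfolding c_def by (intro divide_scalar scalar)
    have "f (x - hscale H c w) = 0"
      unfolding f.diff scale[OF c] using fw u by (simp add: c_def)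
    then have "hinner H w (x - hscale H c w) = 0"
      using orth by (simp add: N_def w_def)
    then have "hinner H (x - hscale H c w) w = 0"
      by (rule hinner_swap_zero)
    then have "hinner H x w = c * of_real ((norm w)\<^sup>2)"
      by (simp add: hinner_diff_left hinner_scale_left[OF c] norm_eq)
    then have "cnj (cnj (f w) / of_real ((norm w)\<^sup>2)) * hinner H x w = f x"
      using w0 fw u by (simp add: c_def)
    then show ?thesis
      by (subst hinner_scale_right) (auto intro!: divide_scalar cnj_scalar scalar simp del: of_real_power)
  qed
  then show thesis using that by blast
qed

end

section \<open>Bounded operators and adjoints\<close>

lemma bounded_op_linear: "bounded_op F H1 H2 A \<Longrightarrow> bounded_linear A"
  by (simp add: bounded_op_def)

lemma bounded_op_scale: "bounded_op F H1 H2 A \<Longrightarrow> c \<in> F \<Longrightarrow> A (hscale H1 c x) = hscale H2 c (A x)"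
  by (simp add: bounded_op_def)

lemma bounded_op_id: "bounded_op F H H (\<lambda>x. x)"
  by (simp add: bounded_op_def bounded_linear_ident)

lemma bounded_op_compose:
  "bounded_op F H2 H3 B \<Longrightarrow> bounded_op F H1 H2 A \<Longrightarrow> bounded_op F H1 H3 (\<lambda>x. B (A x))"
  by (simp add: bounded_op_def bounded_linear_compose)

context hilbert_space
begin

section \<open>Sums, projections, inverses and uniform boundedness\<close>

lemma bounded_op_add:
  "bounded_op F H' H A \<Longrightarrow> bounded_op F H' H B \<Longrightarrow> bounded_op F H' H (\<lambda>x. A x + B x)"
  by (simp add: bounded_op_def bounded_linear_add scale_add_right)

lemma bounded_op_diff:
  "bounded_op F H' H A \<Longrightarrow> bounded_op F H' H B \<Longrightarrow> bounded_op F H' H (\<lambda>x. A x - B x)"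
  by (simp add: bounded_op_def bounded_linear_sub hscale_diff)

lemma bounded_op_sum:
  "(\<And>i. i \<in> I \<Longrightarrow> bounded_op F H' H (A i)) \<Longrightarrow> bounded_op F H' H (\<lambda>x. \<Sum>i\<in>I. A i x)"
  by (simp add: bounded_op_def bounded_linear_sum hscale_sum)

text \<open>A point of \<open>M\<close> with residual orthogonal to \<open>M\<close> is unique
  (\<open>P_eqI\<close>), which yields additivity and homogeneity. Orthogonality of the residuals
  also gives self-adjointness and the norm bound 1.\<close>

lemma projection_operator:
  assumes M: "closed_subspace M"
  obtains P where "bounded_op F H H P" "\<And>x. P x \<in> M" "\<And>x. x \<in> M \<Longrightarrow> P x = x"
    "\<And>x y. hinner H (P x) y = hinner H x (P y)" "\<And>x y. y \<in> M \<Longrightarrow> hinner H (x - P x) y = 0"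
proof -
  have "\<exists>P. \<forall>x. P x \<in> M \<and> (\<forall>m\<in>M. hinner H (x - P x) m = 0)"
    by (rule choice) (metis M orthogonal_projection)
  then obtain P where PM: "\<And>x. P x \<in> M" and orth: "\<And>x y. y \<in> M \<Longrightarrow> hinner H (x - P x) y = 0"
    by blast
  have P_eqI: "P x = p" if p: "p \<in> M" "\<And>m. m \<in> M \<Longrightarrow> hinner H (x - p) m = 0" for x p
  proof -
    have d: "P x - p \<in> M"
      using closed_subspace_diff[OF M PM p(1)] .
    have "hinner H (P x - p) (P x - p) = hinner H (x - p) (P x - p) - hinner H (x - P x) (P x - p)"
      by (simp flip: hinner_diff_left)
    then show ?thesis
      using p(2)[OF d] orth[OF d] by (simp add: hinner_self_eq_0)
  qed
  have add: "P (x + y) = P x + P y" for x y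
    using M PM orth[of _ x] orth[of _ y]
    by (intro P_eqI) (auto simp: closed_subspace_def hinner_add_left hinner_diff_left)
  have scale: "P (hscale H c x) = hscale H c (P x)" if "c \<in> F" for c x
    using M PM orth[of _ x] that
    by (intro P_eqI) (auto simp: closed_subspace_def hinner_scale_left simp flip: hscale_diff)
  have selfadj: "hinner H (P x) y = hinner H x (P y)" for x y
    using orth[OF PM[of y], of x] hinner_swap_zero[OF orth[OF PM[of x], of y]]
    by (simp add: hinner_diff_left hinner_diff_right)
  have bound: "norm (P x) \<le> norm x * 1" for x
  proof -
    have "of_real ((norm (P x))\<^sup>2) = hinner H x (P x)"
      using orth[OF PM[of x], of x] by (simp add: hinner_diff_left norm_eq)
    then have "(norm (P x))\<^sup>2 \<le> norm x * norm (P x)"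
      using Cauchy_Schwarz[of x "P x"] by (metis abs_of_nonneg norm_of_real zero_le_power2)
    then show ?thesis
      by (cases "norm (P x) = 0") (auto simp: power2_eq_square)
  qed
  have "P (r *\<^sub>R x) = r *\<^sub>R P x" for r x
    using scale[OF of_real_scalar] by (simp add: scale_of_real)
  then have "bounded_linear P"
    using add bound by (intro bounded_linear_intro)
  then have "bounded_op F H H P"
    using scale by (simp add: bounded_op_def)
  moreover have "P x = x" if "x \<in> M" for x
    using that by (intro P_eqI) auto
  ultimately show thesis
    using that PM selfadj orth by blast
qed

lemma closed_subspace_range:
  fixes T :: "'c::banach \<Rightarrow> 'a"
  assumes T: "bounded_op F H' H T" and cl: "closed (range T)"
  shows "closed_subspace (range T)"
proof -
  interpret T: bounded_linear T
    using T by (rule bounded_op_linear)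
  show ?thesis
    unfolding closed_subspace_def
  proof (intro conjI ballI)
    show "0 \<in> range T"
      by (rule range_eqI[of _ _ 0]) (simp add: T.zero)
    show "x + y \<in> range T" if "x \<in> range T" "y \<in> range T" for x y
      using that by (auto simp flip: T.add)
    show "hscale H c x \<in> range T" if "c \<in> F" "x \<in> range T" for c x
      using that by (auto simp flip: bounded_op_scale[OF T])
  qed (rule cl)
qed

text \<open>Lax--Milgram for self-adjoint operators: bounded below gives closed range, self-adjointness
  makes the orthogonal complement of the range the (trivial) kernel.\<close>
lemma coercive_selfadjoint_inverse:
  assumes T: "bounded_op F H H T" and selfadj: "\<And>x y. hinner H (T x) y = hinner H x (T y)"
    and c: "c > 0" and coercive: "\<And>x. c * (norm x)\<^sup>2 \<le> Re (hinner H (T x) x)"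
  obtains V where "bounded_op F H H V" "\<And>x. T (V x) = x" "\<And>x. V (T x) = x"
    "\<And>x y. hinner H (V x) y = hinner H x (V y)"
proof -
  interpret T: bounded_linear T
    using T by (rule bounded_op_linear)
  have below: "c * norm x \<le> norm (T x)" for x
  proof (cases "x = 0")
    case False
    have "c * (norm x)\<^sup>2 \<le> norm (T x) * norm x"
      using coercive[of x] Cauchy_Schwarz[of "T x" x] complex_Re_le_cmod[of "hinner H (T x) x"]
      by linarith
    then show ?thesis
      using False by (simp add: power2_eq_square)
  qed simp
  have inj: "inj T"
  proof (rule injI)
    fix x y assume "T x = T y"
    then have "c * norm (x - y) \<le> 0"
      using below[of "x - y"] by (simp add: T.diff)
    then show "x = y"
      using c by (simp add: mult_le_0_iff)
  qed
  have "complete (range T)"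
    using complete_isometric_image[OF c subspace_UNIV T.bounded_linear_axioms _ complete_UNIV] below
    by simp
  then have M: "closed_subspace (range T)"
    by (intro closed_subspace_range[OF T] complete_imp_closed)
  have surj: "y \<in> range T" for y
  proof -
    obtain p where p: "p \<in> range T" and orth: "\<And>m. m \<in> range T \<Longrightarrow> hinner H (y - p) m = 0"
      using orthogonal_projection[OF M] by blast
    have "hinner H (T (y - p)) x = 0" for x
      using orth[of "T x"] by (simp add: selfadj)
    then have "T (y - p) = 0"
      using hinner_self_eq_0 by blast
    then have "y = p"
      using inj T.zero by (metis eq_iff_diff_eq_0 injD)
    with p show ?thesis by simp
  qed
  define V where "V = inv T"
  have TV: "T (V x) = x" for x
    unfolding V_def using surj by (rule f_inv_into_f)
  have VT: "V (T x) = x" for x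
    unfolding V_def using inj by (rule inv_f_f)
  have scale: "V (hscale H d x) = hscale H d (V x)" if "d \<in> F" for d x
    by (metis TV VT bounded_op_scale[OF T that])
  have "bounded_linear V"
  proof (rule bounded_linear_intro)
    show "V (x + y) = V x + V y" for x y
      by (metis TV VT T.add)
    show "V (r *\<^sub>R x) = r *\<^sub>R V x" for r x
      by (metis TV VT T.scaleR)
    show "norm (V x) \<le> norm x * (1 / c)" for x
      using below[of "V x"] c by (simp add: TV field_simps)
  qed
  then have "bounded_op F H H V"
    using scale by (simp add: bounded_op_def)
  moreover have "hinner H (V x) y = hinner H x (V y)" for x y
    by (metis selfadj TV)
  ultimately show thesis
    using that TV VT by blast
qed

text \<open>Banach-Steinhaus for the functionals given by the vectors in \<open>Y\<close>: the
  closed sets \<open>E n\<close> cover the space, so by Baire one of them contains a ball.\<close>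

lemma uniform_boundedness_hinner:
  assumes pointwise: "\<And>x. \<exists>b. \<forall>y\<in>Y. cmod (hinner H x y) \<le> b"
  obtains b where "b > 0" "\<And>y. y \<in> Y \<Longrightarrow> norm y \<le> b"
proof -
  define E where "E n = {x. \<forall>y\<in>Y. cmod (hinner H x y) \<le> real n}" for n :: nat
  have cl: "closed (E n)" for n
  proof -
    have "E n = (\<Inter>y\<in>Y. {x. cmod (hinner H x y) \<le> real n})"
      by (auto simp: E_def)
    then show ?thesis
      by (auto intro!: closed_INT closed_Collect_le continuous_intros
          linear_continuous_on[OF bounded_linear_hinner_left])
  qed
  have "(\<Union>n. E n) = UNIV"
  proof (intro equalityI subset_UNIV subsetI)
    fix x :: 'a
    obtain b where "\<forall>y\<in>Y. cmod (hinner H x y) \<le> b"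
      using pointwise by blast
    moreover obtain n :: nat where "b \<le> real n"
      using real_arch_simple by blast
    ultimately have "x \<in> E n"
      unfolding E_def using order_trans by blast
    then show "x \<in> (\<Union>n. E n)"
      by blast
  qed
  then have "euclidean interior_of \<Union>(range E) \<noteq> {}"
    by simp
  then have "\<exists>n. euclidean interior_of (E n) \<noteq> {}"
    using cl Baire_category_alt[of "euclidean :: 'a topology" "range E"]
      completely_metrizable_space_euclidean by fastforce
  then obtain n where "interior (E n) \<noteq> {}"
    by auto
  then obtain z e where e: "e > 0" and ball: "ball z e \<subseteq> E n"
    by (metis equals0I mem_interior)
  \<comment> \<open>The vector \<open>u\<close> of length \<open>e / 2\<close> in the direction of
    \<open>y\<close> is a difference of two points of \<open>E n\<close>, so its inner product with
    \<open>y\<close>, which is \<open>e / 2 * norm y\<close>, is at most \<open>2 * real n\<close>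
    in modulus.\<close>
  have "norm y \<le> 4 * real n / e" if y: "y \<in> Y" for y
  proof (cases "y = 0")
    case False
    define u where "u = (e / (2 * norm y)) *\<^sub>R y"
    have "norm u = e / 2"
      using False e by (simp add: u_def)
    then have "z + u \<in> E n" "z \<in> E n"
      using ball e by (auto simp: dist_norm)
    then have "cmod (hinner H (z + u) y) \<le> real n" "cmod (hinner H z y) \<le> real n"
      using y by (auto simp: E_def)
    then have "cmod (hinner H (z + u) y - hinner H z y) \<le> 2 * real n"
      by (metis add_mono mult_2 norm_triangle_le_diff)
    then have "cmod (hinner H u y) \<le> 2 * real n"
      by (simp add: hinner_add_left)
    moreover have "hinner H u y = of_real (e / 2 * norm y)"
      using False by (simp add: u_def hinner_scaleR_left norm_eq power2_eq_square)
    ultimately show ?thesis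
      using e by (simp add: norm_mult field_simps)
  qed (use e in simp)
  \<comment> \<open>Adding 1 keeps the bound positive when \<open>n = 0\<close>.\<close>
  then show thesis
    using that[of "4 * real n / e + 1"] e
    by (metis add_nonneg_pos add_increasing2 divide_nonneg_pos mult_nonneg_nonneg of_nat_0_le_iff
        zero_le_numeral zero_less_one zero_le_one)
qed

end

section \<open>Existence and boundedness of the adjoint\<close>

locale hilbert_space_pair = dom: hilbert_space F H1 + cod: hilbert_space F H2
  for F and H1 :: "('a::banach) hilbert_str" and H2 :: "('b::banach) hilbert_str"
begin

lemma hadjoint_eqI:
  assumes "\<And>x y. hinner H2 (A x) y = hinner H1 x (B y)"
  shows "hadjoint H1 H2 A = B"
  unfolding hadjoint_def
proof (rule the_equality)
  fix C assume "\<forall>x y. hinner H2 (A x) y = hinner H1 x (C y)"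
  then have "C y = B y" for y
    using assms by (intro dom.hinner_eqI_right) metis
  then show "C = B" by blast
qed (use assms in simp)

context
  fixes A assumes A: "bounded_op F H1 H2 A"
begin

text \<open>Riesz representation of the functional sending \<open>x\<close> to
  \<open>hinner H2 (A x) y\<close> supplies a value for each \<open>y\<close>, so the description in
  \<open>hadjoint\<close> denotes.\<close>

lemma hinner_hadjoint: "hinner H2 (A x) y = hinner H1 x (hadjoint H1 H2 A y)"
proof -
  have "\<exists>z. \<forall>x. hinner H2 (A x) y = hinner H1 x z" for y
  proof -
    have "bounded_linear (\<lambda>x. hinner H2 (A x) y)"
      using cod.bounded_linear_hinner_left bounded_op_linear[OF A] by (rule bounded_linear_compose)
    then obtain z where "\<And>x. hinner H2 (A x) y = hinner H1 x z"
      by (rule dom.Riesz_representation)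
        (simp_all add: bounded_op_scale[OF A] cod.hinner_scale_left cod.hinner_scalar)
    then show ?thesis by blast
  qed
  then obtain B where "\<And>x y. hinner H2 (A x) y = hinner H1 x (B y)"
    by metis
  with hadjoint_eqI[of A B] show ?thesis by simp
qed

lemma hinner_hadjoint_left: "hinner H1 (hadjoint H1 H2 A y) x = hinner H2 y (A x)"
  by (metis hinner_hadjoint dom.hinner_commute cod.hinner_commute)

text \<open>Linearity is tested against arbitrary vectors. The bound \<open>K\<close> of
  \<open>A\<close> also serves the adjoint: the square of \<open>norm (?B y)\<close> equals
  \<open>hinner H2 y (A (?B y))\<close>, and one factor cancels after Cauchy-Schwarz.\<close>

lemma bounded_op_hadjoint: "bounded_op F H2 H1 (hadjoint H1 H2 A)"
proof -
  let ?B = "hadjoint H1 H2 A"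
  obtain K where K: "\<And>x. norm (A x) \<le> norm x * K" "0 < K"
    using bounded_linear.pos_bounded[OF bounded_op_linear[OF A]] by blast
  have scale: "?B (hscale H2 c y) = hscale H1 c (?B y)" if "c \<in> F" for c y
    by (rule dom.hinner_eqI_left)
      (simp add: that dom.hinner_scale_left cod.hinner_scale_left hinner_hadjoint_left)
  have "bounded_linear ?B"
  proof (rule bounded_linear_intro)
    show "?B (x + y) = ?B x + ?B y" for x y
      by (rule dom.hinner_eqI_left)
        (simp add: dom.hinner_add_left cod.hinner_add_left hinner_hadjoint_left)
    show "?B (r *\<^sub>R y) = r *\<^sub>R ?B y" for r y
      using scale[of "of_real r"] by (simp add: dom.scale_of_real cod.scale_of_real)
    show "norm (?B y) \<le> norm y * K" for y
    proof -
      have "of_real ((norm (?B y))\<^sup>2) = hinner H2 y (A (?B y))"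
        by (simp only: dom.norm_eq[symmetric] hinner_hadjoint_left)
      then have "(norm (?B y))\<^sup>2 \<le> norm y * norm (A (?B y))"
        using cod.Cauchy_Schwarz by (metis abs_of_nonneg norm_of_real zero_le_power2)
      also have "\<dots> \<le> norm y * (norm (?B y) * K)"
        by (intro mult_left_mono K) simp
      finally show ?thesis
        using K(2) by (cases "norm (?B y) = 0") (auto simp: power2_eq_square mult_ac)
    qed
  qed
  then show ?thesis
    using scale by (simp add: bounded_op_def)
qed

end

end

section \<open>Moore--Penrose inverses\<close>

text \<open>The range of \<open>X\<close> is the fixed point set of the continuous map
  \<open>X \<circ> A\<close>.\<close>

lemma closed_range_inner_inverse:
  fixes X :: "'b::real_normed_vector \<Rightarrow> 'a::real_normed_vector"
  assumes X: "bounded_linear X" and A: "bounded_linear A" and XAX: "\<And>y. X (A (X y)) = X y"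
  shows "closed (range X)"
proof -
  have "range X = {x. X (A x) = x}"
    using XAX by (auto intro: range_eqI[OF sym])
  moreover have "closed {x. X (A x) = x}"
    by (intro closed_Collect_eq linear_continuous_on bounded_linear_compose[OF X A] bounded_linear_ident)
  ultimately show ?thesis by simp
qed

lemma (in hilbert_space) hilbert_space_pair_self: "hilbert_space_pair F H H"
  by (intro hilbert_space_pair.intro hilbert_space_axioms)

lemma (in hilbert_space) hadjoint_eq_self_iff:
  assumes T: "bounded_op F H H T"
  shows "hadjoint H H T = T \<longleftrightarrow> (\<forall>x y. hinner H (T x) y = hinner H x (T y))"
proof -
  interpret self: hilbert_space_pair F H H
    by (rule hilbert_space_pair_self)
  show ?thesis
    using self.hinner_hadjoint[OF T] self.hadjoint_eqI[of T T] by metis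
qed

context hilbert_space_pair
begin

lemma hilbert_space_pair_swap: "hilbert_space_pair F H2 H1"
  by (intro hilbert_space_pair.intro dom.hilbert_space_axioms cod.hilbert_space_axioms)

text \<open>The working form of the definition: closedness of the range of \<open>X\<close> follows
  from the second equation, and the adjoint conditions become symmetry of the inner product.\<close>

lemma is_mp_inverse_iff:
  assumes A: "bounded_op F H1 H2 A"
  shows "is_mp_inverse F H1 H2 A X \<longleftrightarrow> bounded_op F H2 H1 X \<and>
    (\<forall>x. A (X (A x)) = A x) \<and> (\<forall>y. X (A (X y)) = X y) \<and>
    (\<forall>x y. hinner H2 (A (X x)) y = hinner H2 x (A (X y))) \<and>
    (\<forall>x y. hinner H1 (X (A x)) y = hinner H1 x (X (A y)))"
    (is "?L \<longleftrightarrow> ?R")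
proof (cases "bounded_op F H2 H1 X")
  case True
  note ops = bounded_op_compose[OF A True] bounded_op_compose[OF True A]
  have "closed (range X)" if "\<forall>y. X (A (X y)) = X y"
    using that closed_range_inner_inverse[OF True[THEN bounded_op_linear] A[THEN bounded_op_linear]]
    by blast
  then show ?thesis
    using True
    unfolding is_mp_inverse_def BC_def comp_def
      cod.hadjoint_eq_self_iff[OF ops(1)] dom.hadjoint_eq_self_iff[OF ops(2)]
    by (auto simp: fun_eq_iff)
qed (simp add: is_mp_inverse_def BC_def)

text \<open>\<open>A \<circ> X\<close> and \<open>A \<circ> Y\<close> are self-adjoint projections
  onto the same range, hence equal; likewise \<open>X \<circ> A\<close> and
  \<open>Y \<circ> A\<close>. Then XAX = XAY = YAY.\<close>

lemma is_mp_inverse_unique: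
  assumes A: "bounded_op F H1 H2 A"
    and X: "is_mp_inverse F H1 H2 A X" and Y: "is_mp_inverse F H1 H2 A Y"
  shows "X = Y"
proof
  fix y
  note X = X[unfolded is_mp_inverse_iff[OF A]] and Y = Y[unfolded is_mp_inverse_iff[OF A]]
  have AX: "A (X u) = A (Y u)" for u
    by (rule cod.hinner_eqI_left) (metis X Y)
  have XA: "X (A u) = Y (A u)" for u
    by (rule dom.hinner_eqI_left) (metis X Y)
  show "X y = Y y"
    by (metis X Y AX XA)
qed

text \<open>The open mapping theorem for \<open>A\<close>, in dual form: the vectors \<open>y\<close> in the range of \<open>A\<close> with
  \<open>\<parallel>A\<^sup>* y\<parallel> \<le> 1\<close> are pointwise, hence uniformly, bounded.\<close>
lemma hadjoint_bounded_below:
  assumes "A \<in> BC F H1 H2"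
  obtains r where "r > 0" "\<And>y. y \<in> range A \<Longrightarrow> r * norm y \<le> norm (hadjoint H1 H2 A y)"
proof -
  have A: "bounded_op F H1 H2 A" and cl: "closed (range A)"
    using assms by (auto simp: BC_def)
  let ?B = "hadjoint H1 H2 A"
  interpret A: bounded_linear A
    using A by (rule bounded_op_linear)
  interpret B: bounded_linear ?B
    using bounded_op_hadjoint[OF A] by (rule bounded_op_linear)
  obtain P where PM: "\<And>x. P x \<in> range A"
    and orth: "\<And>x y. y \<in> range A \<Longrightarrow> hinner H2 (x - P x) y = 0"
    by (rule cod.projection_operator[OF cod.closed_subspace_range[OF A cl]]) blast
  define Y where "Y = {y \<in> range A. norm (?B y) \<le> 1}"
  have "\<exists>b. \<forall>y\<in>Y. cmod (hinner H2 x y) \<le> b" for x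
  proof -
    \<comment> \<open>Against \<open>y\<close> in the range of \<open>A\<close> only
      \<open>P x\<close> counts, and a preimage \<open>u\<close> of it moves the estimate to
      \<open>?B y\<close>.\<close>
    obtain u where u: "P x = A u"
      using PM by blast
    have "cmod (hinner H2 x y) \<le> norm u" if "y \<in> Y" for y
    proof -
      have "hinner H2 x y = hinner H1 u (?B y)"
        using that orth[of y x] by (simp add: Y_def cod.hinner_diff_left u hinner_hadjoint[OF A])
      also have "cmod \<dots> \<le> norm u * norm (?B y)"
        by (rule dom.Cauchy_Schwarz)
      also have "\<dots> \<le> norm u"
        using that by (simp add: Y_def mult_left_le)
      finally show ?thesis .
    qed
    then show ?thesis by blast
  qed
  then obtain b where b: "b > 0" "\<And>y. y \<in> Y \<Longrightarrow> norm y \<le> b"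
    using cod.uniform_boundedness_hinner by blast
  have scaled: "t * norm y \<le> b" if "y \<in> range A" "t \<ge> 0" "t * norm (?B y) \<le> 1" for y t
  proof -
    have "t *\<^sub>R y \<in> range A"
      using that(1) by (metis A.scaleR imageE rangeI)
    then have "t *\<^sub>R y \<in> Y"
      using that by (simp add: Y_def B.scaleR)
    then show ?thesis
      using b(2) that(2) by fastforce
  qed
  have "1 / b * norm y \<le> norm (?B y)" if y: "y \<in> range A" for y
  proof (cases "?B y = 0")
    case True
    \<comment> \<open>Here \<open>y\<close> lies in the range of \<open>A\<close> and is orthogonal
      to it.\<close>
    then have "hinner H2 y x = 0" if "x \<in> range A" for x
      using that by (auto simp flip: hinner_hadjoint_left[OF A])
    then have "y = 0"
      using y cod.hinner_self_eq_0 by blast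
    then show ?thesis by simp
  next
    case False
    then show ?thesis
      using scaled[OF y, of "1 / norm (?B y)"] b(1) by (simp add: field_simps)
  qed
  then show thesis
    using that[of "1 / b"] b(1) by simp
qed

text \<open>With \<open>P\<close> the projection onto the range of \<open>A\<close>, the operator \<open>T = A A\<^sup>* + (1 - P)\<close> is coercive
  and commutes with \<open>P\<close>; the inverse is \<open>A\<^sup>* T\<^sup>-\<^sup>1 P\<close>.\<close>
lemma is_mp_inverse_exists:
  assumes BC: "A \<in> BC F H1 H2"
  shows "\<exists>X. is_mp_inverse F H1 H2 A X"
proof -
  have A: "bounded_op F H1 H2 A" and cl: "closed (range A)"
    using BC by (auto simp: BC_def)
  define B where "B = hadjoint H1 H2 A"
  note AB = hinner_hadjoint[OF A, folded B_def] and BA = hinner_hadjoint_left[OF A, folded B_def]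
  have B: "bounded_op F H2 H1 B"
    unfolding B_def by (rule bounded_op_hadjoint[OF A])
  interpret A: bounded_linear A using A by (rule bounded_op_linear)
  interpret B: bounded_linear B using B by (rule bounded_op_linear)
  obtain P where P: "bounded_op F H2 H2 P" and PM: "\<And>x. P x \<in> range A"
    and P_id: "\<And>x. x \<in> range A \<Longrightarrow> P x = x"
    and P_self: "\<And>x y. hinner H2 (P x) y = hinner H2 x (P y)"
    and orth: "\<And>x y. y \<in> range A \<Longrightarrow> hinner H2 (x - P x) y = 0"
    by (rule cod.projection_operator[OF cod.closed_subspace_range[OF A cl]]) blast
  interpret P: bounded_linear P using P by (rule bounded_op_linear)
  have PA: "P (A x) = A x" for x
    by (simp add: P_id)
  \<comment> \<open>The dual of \<open>PA\<close>: the adjoint vanishes on the orthogonal complement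
    of the range of \<open>A\<close>.\<close>
  have BP: "B (P y) = B y" for y
    by (rule dom.hinner_eqI_left) (simp add: BA P_self PA)
  define T where "T y = A (B y) + (y - P y)" for y
  have T: "bounded_op F H2 H2 T"
    unfolding T_def
    by (intro cod.bounded_op_add cod.bounded_op_diff bounded_op_compose[OF A B] bounded_op_id P)
  have T_self: "hinner H2 (T x) y = hinner H2 x (T y)" for x y
    by (simp add: T_def cod.hinner_add_left cod.hinner_add_right cod.hinner_diff_left
        cod.hinner_diff_right AB BA P_self)
  obtain r where r: "r > 0" and below: "\<And>y. y \<in> range A \<Longrightarrow> r * norm y \<le> norm (B y)"
    unfolding B_def by (rule hadjoint_bounded_below[OF BC]) blast
  \<comment> \<open>\<open>r\<^sup>2\<close> serves the component in the range of \<open>A\<close>,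
    where \<open>T\<close> acts as \<open>A \<circ> B\<close>; 1 serves the orthogonal component,
    where \<open>T\<close> is the identity.\<close>
  define c where "c = min 1 (r\<^sup>2)"
  have "c * (norm y)\<^sup>2 \<le> Re (hinner H2 (T y) y)" for y
  proof -
    have "hinner H2 (y - P y) (P y) = 0"
      by (rule orth[OF PM])
    then have split: "hinner H2 (y - P y) y = hinner H2 (y - P y) (y - P y)"
      by (simp add: cod.hinner_diff_right)
    have "hinner H2 y y = hinner H2 (P y) (P y) + hinner H2 (y - P y) (y - P y)"
      using orth[OF PM, of y y] P_self[of y y]
      by (simp add: P_id PM cod.hinner_diff_left cod.hinner_diff_right)
    then have pyth: "(norm y)\<^sup>2 = (norm (P y))\<^sup>2 + (norm (y - P y))\<^sup>2"
      by (simp add: cod.norm_square)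
    have "(r * norm (P y))\<^sup>2 \<le> (norm (B y))\<^sup>2"
      using below[OF PM, of y] r by (intro power_mono) (auto simp: BP)
    moreover have "c * (norm (P y))\<^sup>2 \<le> r\<^sup>2 * (norm (P y))\<^sup>2" "c * (norm (y - P y))\<^sup>2 \<le> 1 * (norm (y - P y))\<^sup>2"
      unfolding c_def by (intro mult_right_mono; simp)+
    ultimately have "c * (norm y)\<^sup>2 \<le> (norm (B y))\<^sup>2 + (norm (y - P y))\<^sup>2"
      by (simp add: pyth distrib_left power_mult_distrib)
    also have "\<dots> = Re (hinner H2 (T y) y)"
      unfolding T_def cod.hinner_add_left split by (simp add: AB dom.norm_square cod.norm_square)
    finally show ?thesis .
  qed
  moreover have "c > 0"
    using r by (simp add: c_def)
  ultimately obtain V where V: "bounded_op F H2 H2 V" and TV: "\<And>x. T (V x) = x"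
    and VT: "\<And>x. V (T x) = x" and V_self: "\<And>x y. hinner H2 (V x) y = hinner H2 x (V y)"
    using cod.coercive_selfadjoint_inverse[OF T T_self] by metis
  have TP: "T (P y) = A (B y)" and PT: "P (T y) = A (B y)" for y
    by (simp_all add: T_def BP PA P_id PM P.add P.diff)
  have VP: "V (P y) = P (V y)" for y
    by (metis TP PT TV VT)
  define X where "X y = B (V (P y))" for y
  have X: "bounded_op F H2 H1 X"
    unfolding X_def by (intro bounded_op_compose[OF B] bounded_op_compose[OF V] P)
  have AX: "A (X y) = P y" for y
    by (simp add: X_def TV P_id PM flip: PT)
  \<comment> \<open>In this form symmetry is visible: \<open>B\<close> is the adjoint of
    \<open>A\<close> and \<open>V\<close> is self-adjoint.\<close>
  have XA: "X (A x) = B (V (A x))" for x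
    by (simp add: X_def PA)
  have "X (P y) = X y" for y
    by (simp add: X_def P_id PM)
  then have "is_mp_inverse F H1 H2 A X"
    by (simp add: is_mp_inverse_iff[OF A] X AX P_id P_self XA[symmetric])
      (simp add: XA AB BA V_self)
  then show ?thesis by blast
qed

lemma is_mp_inverse_mp_inverse:
  assumes "A \<in> BC F H1 H2"
  shows "is_mp_inverse F H1 H2 A (mp_inverse F H1 H2 A)"
proof -
  have "bounded_op F H1 H2 A"
    using assms by (simp add: BC_def)
  then have "\<exists>!X. is_mp_inverse F H1 H2 A X"
    using is_mp_inverse_exists[OF assms] is_mp_inverse_unique by blast
  then show ?thesis
    unfolding mp_inverse_def by (rule theI')
qed

end

section \<open>Mutually orthogonal families\<close>

text \<open>The last two assumptions are the inclusions of ranges in null spaces, stated pointwise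
  for direct rewriting.\<close>

locale orthogonal_family = hilbert_space_pair F H1 H2
  for F and H1 :: "('a::banach) hilbert_str" and H2 :: "('b::banach) hilbert_str" +
  fixes I :: "'i set" and A :: "'i \<Rightarrow> 'a \<Rightarrow> 'b"
  assumes finite_I: "finite I"
    and BC: "k \<in> I \<Longrightarrow> A k \<in> BC F H1 H2"
    and hadjoint_A_zero: "k \<in> I \<Longrightarrow> l \<in> I \<Longrightarrow> k \<noteq> l \<Longrightarrow> hadjoint H1 H2 (A l) (A k x) = 0"
    and A_hadjoint_zero: "k \<in> I \<Longrightarrow> l \<in> I \<Longrightarrow> k \<noteq> l \<Longrightarrow> A l (hadjoint H1 H2 (A k) y) = 0"
begin

abbreviation "B k \<equiv> hadjoint H1 H2 (A k)"
abbreviation "X k \<equiv> mp_inverse F H1 H2 (A k)"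

definition "S y = (\<Sum>k\<in>I. A k (B k y))"
text \<open>Each summand is the Moore-Penrose inverse of the matching summand of \<open>S\<close>;
  orthogonality lets these inverses be added.\<close>

definition "G y = (\<Sum>k\<in>I. hadjoint H2 H1 (X k) (X k y))"

section \<open>Cross terms of the family\<close>

lemma A: "k \<in> I \<Longrightarrow> bounded_op F H1 H2 (A k)"
  using BC by (auto simp: BC_def)

lemma AXA: "k \<in> I \<Longrightarrow> A k (X k (A k x)) = A k x"
  and XAX: "k \<in> I \<Longrightarrow> X k (A k (X k y)) = X k y"
  and AX_self: "k \<in> I \<Longrightarrow> hinner H2 (A k (X k y)) z = hinner H2 y (A k (X k z))"
  and XA_self: "k \<in> I \<Longrightarrow> hinner H1 (X k (A k x)) u = hinner H1 x (X k (A k u))"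
  and X: "k \<in> I \<Longrightarrow> bounded_op F H2 H1 (X k)"
  using is_mp_inverse_iff[OF A, of k "X k"] is_mp_inverse_mp_inverse[OF BC, of k] by auto

lemma bounded_op_S: "bounded_op F H2 H2 S"
  unfolding S_def by (intro cod.bounded_op_sum bounded_op_compose[OF A bounded_op_hadjoint[OF A]])

lemma bounded_op_G: "bounded_op F H2 H2 G"
proof -
  interpret swap: hilbert_space_pair F H2 H1 by (rule hilbert_space_pair_swap)
  show ?thesis
    unfolding G_def
    by (intro cod.bounded_op_sum bounded_op_compose[OF swap.bounded_op_hadjoint[OF X] X])
qed

lemma linear_A: "k \<in> I \<Longrightarrow> linear (A k)"
  by (rule bounded_linear.linear[OF bounded_op_linear[OF A]])

lemma linear_B: "k \<in> I \<Longrightarrow> linear (B k)"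
  by (rule bounded_linear.linear[OF bounded_op_linear[OF bounded_op_hadjoint[OF A]]])

lemma linear_X: "k \<in> I \<Longrightarrow> linear (X k)"
  by (rule bounded_linear.linear[OF bounded_op_linear[OF X]])

lemma sum_only:
  assumes "k \<in> I" "\<And>l. l \<in> I \<Longrightarrow> l \<noteq> k \<Longrightarrow> f l = (0::'c::comm_monoid_add)"
  shows "(\<Sum>l\<in>I. f l) = f k"
  using assms finite_I by (simp add: sum.remove[of I k])

text \<open>Moving the self-adjoint \<open>A l \<circ> X l\<close> across the inner product leaves
  \<open>B k\<close> applied to a value of \<open>A l\<close>, which is 0. Applying
  \<open>X l\<close> then gives the claim by \<open>XAX\<close>.\<close>

lemma X_A_zero:
  assumes "k \<in> I" "l \<in> I" "k \<noteq> l" shows "X l (A k x) = 0"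
proof -
  have "A l (X l (A k x)) = 0"
    by (rule cod.hinner_eqI_left)
      (simp add: AX_self assms, simp add: hinner_hadjoint[OF A[OF assms(1)]] hadjoint_A_zero assms assms(3)[symmetric])
  then show ?thesis
    by (metis XAX linear_0[OF linear_X[OF assms(2)]] assms(2))
qed

text \<open>The adjoint of the equation AXA = A, with XA self-adjoint.\<close>

lemma XAB: "k \<in> I \<Longrightarrow> X k (A k (B k y)) = B k y"
  by (rule dom.hinner_eqI_left) (simp add: XA_self hinner_hadjoint_left[OF A] AXA)

text \<open>The composite of the two adjoints is the adjoint of \<open>X l \<circ> A k\<close>: zero
  for distinct indices, and otherwise a self-adjoint projection fixing \<open>X k y\<close>.\<close>

lemma B_hadjoint_X:
  assumes "k \<in> I" "l \<in> I"
  shows "B k (hadjoint H2 H1 (X l) (X l y)) = (if k = l then X k y else 0)"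
proof (rule dom.hinner_eqI_left)
  interpret swap: hilbert_space_pair F H2 H1 by (rule hilbert_space_pair_swap)
  fix z
  have "hinner H1 (B k (hadjoint H2 H1 (X l) (X l y))) z = hinner H1 (X l y) (X l (A k z))"
    by (simp add: assms hinner_hadjoint_left[OF A] swap.hinner_hadjoint_left[OF X])
  also have "\<dots> = hinner H1 (if k = l then X k y else 0) z"
    by (simp add: assms X_A_zero XAX flip: XA_self)
  finally show "hinner H1 (B k (hadjoint H2 H1 (X l) (X l y))) z = hinner H1 (if k = l then X k y else 0) z" .
qed

lemma B_G: "k \<in> I \<Longrightarrow> B k (G y) = X k y"
  by (simp add: G_def linear_sum[OF linear_B] B_hadjoint_X finite_I)

text \<open>By \<open>B_G\<close> the vector \<open>X k y\<close> lies in the range of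
  \<open>B k\<close>, which \<open>A l\<close> annihilates.\<close>

lemma A_X_zero:
  assumes "k \<in> I" "l \<in> I" "k \<noteq> l" shows "A l (X k y) = 0"
  by (metis A_hadjoint_zero B_G assms)

lemma X_S: "k \<in> I \<Longrightarrow> X k (S y) = B k y"
  by (simp add: S_def linear_sum[OF linear_X] X_A_zero XAB sum_only[of k])

lemma S_G: "S (G y) = (\<Sum>k\<in>I. A k (X k y))"
  by (simp add: S_def B_G)

section \<open>The Moore-Penrose equations for \<open>S\<close> and \<open>G\<close>\<close>

lemma S_self: "hinner H2 (S x) y = hinner H2 x (S y)"
  by (simp add: S_def cod.hinner_sum_left cod.hinner_sum_right hinner_hadjoint[OF A]
      flip: hinner_hadjoint_left[OF A])

lemma G_self: "hinner H2 (G x) y = hinner H2 x (G y)"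
proof -
  interpret swap: hilbert_space_pair F H2 H1 by (rule hilbert_space_pair_swap)
  have "hinner H2 (G x) y = (\<Sum>k\<in>I. hinner H1 (X k x) (X k y))"
    unfolding G_def cod.hinner_sum_left by (intro sum.cong refl swap.hinner_hadjoint_left X)
  also have "\<dots> = hinner H2 x (G y)"
    unfolding G_def cod.hinner_sum_right by (intro sum.cong refl swap.hinner_hadjoint X)
  finally show ?thesis .
qed

lemma S_G_self: "hinner H2 (S (G x)) y = hinner H2 x (S (G y))"
  by (simp add: S_G cod.hinner_sum_left cod.hinner_sum_right AX_self)

text \<open>\<open>G \<circ> S\<close> is the adjoint of \<open>S \<circ> G\<close>, which is itself
  self-adjoint as a sum of the projections \<open>A k \<circ> X k\<close>.\<close>

lemma G_S: "G (S y) = S (G y)"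
  by (rule cod.hinner_eqI_left) (metis S_self G_self S_G_self)

lemma S_G_S: "S (G (S y)) = S y"
  by (simp add: S_G X_S) (simp add: S_def)

lemma G_S_G: "G (S (G y)) = G y"
  by (simp add: G_def[of "S (G y)"] X_S B_G) (simp add: G_def)

lemma is_mp_inverse_S: "is_mp_inverse F H2 H2 S G"
proof -
  interpret self: hilbert_space_pair F H2 H2 by (rule cod.hilbert_space_pair_self)
  show ?thesis
    by (simp add: self.is_mp_inverse_iff[OF bounded_op_S] bounded_op_G S_G_S G_S_G S_G_self)
      (simp add: G_S S_G_self)
qed

lemma ex1_mp_inverse_S: "\<exists>!Y. is_mp_inverse F H2 H2 S Y"
proof -
  interpret self: hilbert_space_pair F H2 H2 by (rule cod.hilbert_space_pair_self)
  show ?thesis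
    using is_mp_inverse_S self.is_mp_inverse_unique[OF bounded_op_S] by blast
qed

lemma mp_inverse_S: "mp_inverse F H2 H2 S = G"
  unfolding mp_inverse_def
  by (rule the_equality[where P = "is_mp_inverse F H2 H2 S"])
    (use is_mp_inverse_S ex1_mp_inverse_S in blast)+

section \<open>The assertions for an orthogonal family\<close>

lemma mp_inverse_eq_diff:
  assumes "k0 \<in> I"
  shows "X k0 y = (\<Sum>k\<in>I. B k (G y)) - (\<Sum>k\<in>I - {k0}. X k y)"
  using assms finite_I by (simp add: B_G sum.remove[of I k0])

text \<open>The null space of \<open>B k0\<close> is the orthogonal complement of the range of
  \<open>A k0\<close>, and it always contains the values of the remaining sum. Both directions split
  \<open>y\<close> along this decomposition.\<close>

lemma range_sum_eq_UNIV_iff: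
  assumes k0: "k0 \<in> I"
  shows "range (\<lambda>x. \<Sum>k\<in>I. A k x) = UNIV \<longleftrightarrow>
    range (\<lambda>x. \<Sum>k\<in>I - {k0}. A k x) = null_space (B k0)"
proof
  have split: "(\<Sum>k\<in>I. A k x) = A k0 x + (\<Sum>k\<in>I - {k0}. A k x)" for x
    using k0 finite_I by (simp add: sum.remove[of I k0])
  have B_rest: "B k0 (\<Sum>k\<in>I - {k0}. A k x) = 0" for x
    by (simp add: linear_sum[OF linear_B] k0 hadjoint_A_zero)
  interpret A0: bounded_linear "A k0" using A[OF k0] by (rule bounded_op_linear)
  interpret B0: bounded_linear "B k0"
    using bounded_op_hadjoint[OF A[OF k0]] by (rule bounded_op_linear)
  {
    assume UNIV: "range (\<lambda>x. \<Sum>k\<in>I. A k x) = UNIV"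
    show "range (\<lambda>x. \<Sum>k\<in>I - {k0}. A k x) = null_space (B k0)"
    proof (intro equalityI subsetI)
      fix y assume y: "y \<in> null_space (B k0)"
      from UNIV have "y \<in> range (\<lambda>x. \<Sum>k\<in>I. A k x)"
        by simp
      then obtain x where x: "y = A k0 x + (\<Sum>k\<in>I - {k0}. A k x)"
        by (auto simp: split)
      then have "B k0 (A k0 x) = 0"
        using y by (simp add: null_space_def B0.add B_rest)
      \<comment> \<open>This is the inner product of \<open>x\<close> with
        \<open>B k0 (A k0 x)\<close>.\<close>
      then have "hinner H2 (A k0 x) (A k0 x) = 0"
        by (simp add: hinner_hadjoint[OF A[OF k0]])
      then have "A k0 x = 0"
        by (simp add: cod.hinner_self_eq_0)
      with x show "y \<in> range (\<lambda>x. \<Sum>k\<in>I - {k0}. A k x)"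
        by simp
    qed (auto simp: null_space_def B_rest)
  next
    assume null: "range (\<lambda>x. \<Sum>k\<in>I - {k0}. A k x) = null_space (B k0)"
    have "y \<in> range (\<lambda>x. \<Sum>k\<in>I. A k x)" for y
    proof -
      \<comment> \<open>\<open>A k0 \<circ> X k0\<close> is the orthogonal projection onto the range
        of \<open>A k0\<close>.\<close>
      have "B k0 (y - A k0 (X k0 y)) = 0"
        by (rule dom.hinner_eqI_left)
          (simp add: B0.diff dom.hinner_diff_left hinner_hadjoint_left[OF A[OF k0]] AX_self k0 AXA)
      then have "y - A k0 (X k0 y) \<in> range (\<lambda>x. \<Sum>k\<in>I - {k0}. A k x)"
        unfolding null by (simp add: null_space_def)
      then obtain x where x: "y - A k0 (X k0 y) = (\<Sum>k\<in>I - {k0}. A k x)"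
        by blast
      \<comment> \<open>One argument must produce both components of \<open>y\<close>. The
        correction of \<open>x\<close> lies in the range of \<open>X k0\<close>, so the other
        operators do not see it, while it changes \<open>A k0 x\<close> into
        \<open>A k0 (X k0 y)\<close>.\<close>
      define z where "z = X k0 (y - A k0 x) + x"
      have "A k0 z = A k0 (X k0 y)"
        by (simp add: z_def A0.add A0.diff linear_diff[OF linear_X] AXA k0)
      moreover have "A k z = A k x" if "k \<in> I - {k0}" for k
      proof -
        have k: "k \<in> I" "k0 \<noteq> k"
          using that by auto
        show ?thesis
          by (simp add: z_def linear_add[OF linear_A[OF k(1)]] A_X_zero[OF k0 k])
      qed
      ultimately have "(\<Sum>k\<in>I. A k z) = y"
        using x by (simp add: split algebra_simps)
      then show ?thesis by blast
    qed
    then show "range (\<lambda>x. \<Sum>k\<in>I. A k x) = UNIV" by blast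
  }
qed

text \<open>\<open>S \<circ> G\<close> is the sum of the projections \<open>A k \<circ> X k\<close>;
  on \<open>y = (\<Sum>k\<in>I. A k x)\<close> each returns its own summand, so \<open>G\<close> is
  a right inverse, and by \<open>G_S\<close> a two-sided one.\<close>

lemma invertible_S:
  assumes "range (\<lambda>x. \<Sum>k\<in>I. A k x) = UNIV"
  shows "invertible_op F H2 H2 S"
proof -
  have "S (G y) = y" for y
  proof -
    have "y \<in> range (\<lambda>x. \<Sum>k\<in>I. A k x)"
      using assms by simp
    then obtain x where y: "y = (\<Sum>k\<in>I. A k x)"
      by blast
    have "X k y = X k (A k x)" if "k \<in> I" for k
      using that by (simp add: y linear_sum[OF linear_X] X_A_zero sum_only[of k])
    then show ?thesis
      by (simp add: S_G AXA y)
  qed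
  then show ?thesis
    unfolding invertible_op_def using bounded_op_S bounded_op_G G_S by (auto simp: fun_eq_iff)
qed

end

theorem theorem2p5:
  fixes F :: "complex set"
    and H1 :: "('a::banach) hilbert_str" and H2 :: "('b::banach) hilbert_str"
    and A :: "nat \<Rightarrow> 'a \<Rightarrow> 'b" and K k0 :: nat
    and S :: "'b \<Rightarrow> 'b"
  defines "S \<equiv> (\<lambda>y. \<Sum>k=1..K. A k (hadjoint H1 H2 (A k) y))"
  assumes "hilbert_space F H1" and "hilbert_space F H2"
    and "K \<ge> 1"
    and "\<And>k. k \<in> {1..K} \<Longrightarrow> A k \<in> BC F H1 H2"
    and "\<And>k k'. k \<in> {1..K} \<Longrightarrow> k' \<in> {1..K} \<Longrightarrow> k \<noteq> k' \<Longrightarrow>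
           range (A k) \<subseteq> null_space (hadjoint H1 H2 (A k'))"
    and "\<And>k k'. k \<in> {1..K} \<Longrightarrow> k' \<in> {1..K} \<Longrightarrow> k \<noteq> k' \<Longrightarrow>
           range (hadjoint H1 H2 (A k)) \<subseteq> null_space (A k')"
    and "k0 \<in> {1..K}"
  shows "(\<exists>!X. is_mp_inverse F H2 H2 S X) \<and>
    mp_inverse F H1 H2 (A k0) =
      (\<lambda>y. (\<Sum>k=1..K. hadjoint H1 H2 (A k) (mp_inverse F H2 H2 S y))
           - (\<Sum>k\<in>{1..K} - {k0}. mp_inverse F H1 H2 (A k) y)) \<and>
    (mp_inverse F H1 H2 (A k0) \<circ> S = hadjoint H1 H2 (A k0) \<and>
     mp_inverse F H1 H2 (A k0) = hadjoint H1 H2 (A k0) \<circ> mp_inverse F H2 H2 S) \<and>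
    (range (\<lambda>x. \<Sum>k=1..K. A k x) = UNIV \<longleftrightarrow>
      range (\<lambda>x. \<Sum>k\<in>{1..K} - {k0}. A k x) = null_space (hadjoint H1 H2 (A k0))) \<and>
    (range (\<lambda>x. \<Sum>k=1..K. A k x) = UNIV \<longrightarrow> invertible_op F H2 H2 S)"
proof -
  interpret fam: orthogonal_family F H1 H2 "{1..K}" A
  proof (intro orthogonal_family.intro hilbert_space_pair.intro orthogonal_family_axioms.intro)
    show "hadjoint H1 H2 (A l) (A k x) = 0" if "k \<in> {1..K}" "l \<in> {1..K}" "k \<noteq> l" for k l x
      using assms(6)[OF that] by (auto simp: null_space_def)
    show "A l (hadjoint H1 H2 (A k) y) = 0" if "k \<in> {1..K}" "l \<in> {1..K}" "k \<noteq> l" for k l y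
      using assms(7)[OF that] by (auto simp: null_space_def)
  qed (use assms(2,3,5) in auto)
  \<comment> \<open>After this identification \<open>mp_inverse_S\<close> replaces the Moore-Penrose
    inverse of the sum by the explicit \<open>fam.G\<close>.\<close>
  have S: "S = fam.S"
    unfolding S_def by (rule ext) (simp only: fam.S_def)
  show ?thesis
    unfolding S fam.mp_inverse_S
  proof (intro conjI impI)
    show "mp_inverse F H1 H2 (A k0) = (\<lambda>y. (\<Sum>k=1..K. hadjoint H1 H2 (A k) (fam.G y))
        - (\<Sum>k\<in>{1..K} - {k0}. mp_inverse F H1 H2 (A k) y))"
      using fam.mp_inverse_eq_diff[OF assms(8)] by (rule ext)
    show "mp_inverse F H1 H2 (A k0) \<circ> fam.S = hadjoint H1 H2 (A k0)"
      by (simp only: fun_eq_iff o_apply fam.X_S[OF assms(8)] simp_thms)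
    show "mp_inverse F H1 H2 (A k0) = hadjoint H1 H2 (A k0) \<circ> fam.G"
      by (simp only: fun_eq_iff o_apply fam.B_G[OF assms(8)] simp_thms)
  qed (use fam.ex1_mp_inverse_S fam.range_sum_eq_UNIV_iff[OF assms(8)] fam.invertible_S in blast)+
qed

end
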